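(* Let $k$ be a real number (not restricted to integers) and let $n\ge 0$ be an integer. Then $$\int_{-\pi}^{\pi} \frac{\cos (nx)}{k+\sin^{2}x}\, dx = \frac{(-1)^{n}+1}{2}\,\pi \left(-\frac{\left(2k+1 + 2 \sqrt{k(k+1)}\right)^{\lfloor n/2 \rfloor} - \left(2k+1 - 2 \sqrt{k(k+1)}\right)^{\lfloor n/2 \rfloor}}{\sqrt{k(k+1)}} + \cosh\!\left(2 \lfloor n/2 \rfloor \sinh^{-1}(\sqrt{k})\right) \frac{2}{\sqrt{k(k+1)}}\right).$$
   Context: $\lfloor\cdot\rfloor$ is the floor function and $\sinh^{-1}$ is the inverse hyperbolic sine.
   Formalization: The identity is proved for real k > 0 only: at k = 0 the right side divides by 0, for -1 ≤ k < 0 the denominator vanishes in the interval and √k is not real, and for k < -1 it fails (k = -2, n = 0: the integral is negative, the right side positive). *)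

theory Defs
  imports "HOL-Analysis.Analysis"
begin

end

theory Submission
  imports Defs
begin

text \<open>
  Put \<open>q = 2k + 1 - 2 sqrt (k (k + 1))\<close>, so that \<open>0 < q < 1\<close> and \<open>1/q\<close> is the other base in the formula.
  Then \<open>1 / (k + sin\<^sup>2 x)\<close> is a multiple of the Poisson kernel
  \<open>(1 - q\<^sup>2) / (1 - 2 q cos 2x + q\<^sup>2)\<close>, whose Fourier coefficients satisfy a three-term
  recurrence because \<open>2 cos ((n + 2) x) cos 2x = cos ((n + 4) x) + cos (n x)\<close>. The first two are
  found from explicit antiderivatives. On the right-hand side,
  \<open>2 cosh (2 m arsinh (sqrt k)) = q^-m + q^m\<close>, so the powers of \<open>1/q\<close> cancel.
\<close>

text \<open>Since \<open>cos t\<close> is at most 1, the expression is at least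
  \<open>(1 - q)\<^sup>2\<close>.\<close>

lemma poisson_denominator_pos:
  fixes q t :: real
  assumes "0 < q" "q < 1"
  shows "0 < 1 - 2 * q * cos t + q\<^sup>2"
proof -
  have "q * cos t \<le> q * 1"
    using assms by (intro mult_left_mono) auto
  moreover have "0 < (1 - q)\<^sup>2"
    using assms by simp
  ultimately show ?thesis
    by (simp add: power2_eq_square algebra_simps)
qed

lemma has_integral_cos_multiple:
  fixes n :: nat
  assumes "0 < n"
  shows "((\<lambda>x::real. cos (real n * x)) has_integral 0) {-pi..pi}"
proof -
  have "((\<lambda>x::real. cos (real n * x)) has_integral
      sin (real n * pi) / real n - sin (real n * (-pi)) / real n) {-pi..pi}"
    using assms
    by (intro fundamental_theorem_of_calculus)
      (auto simp flip: has_real_derivative_iff_has_vector_derivative intro!: derivative_eq_intros)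
  then show ?thesis
    by simp
qed

lemma has_integral_poisson_kernel:
  fixes q :: real
  assumes q: "0 < q" "q < 1"
  shows "((\<lambda>x. (1 - q\<^sup>2) / (1 - 2 * q * cos (2 * x) + q\<^sup>2)) has_integral 2 * pi) {-pi..pi}"
proof -
  \<comment> \<open>The kernel is \<open>1 + 2 * (\<Sum>j\<ge>1. q ^ j * cos (2 * j * x))\<close>.
    Termwise integration gives \<open>x\<close> plus the imaginary part of
    \<open>- ln (1 - q * exp (2 * i * x))\<close>, which is this arctan. As
    \<open>1 - q * cos (2 * x)\<close> stays positive, \<open>F\<close> has no jumps; the arctan
    vanishes at both endpoints, so only \<open>x\<close> contributes.\<close>
  define F where "F x = x + arctan (q * sin (2 * x) / (1 - q * cos (2 * x)))" for x
  have "(F has_real_derivative (1 - q\<^sup>2) / (1 - 2 * q * cos (2 * x) + q\<^sup>2)) (at x within {-pi..pi})" for x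
  proof -
    define c s where "c = cos (2 * x)" and "s = sin (2 * x)"
    have "q * c \<le> q * 1"
      using q unfolding c_def by (intro mult_left_mono) auto
    then have nz: "1 - q * c \<noteq> 0"
      using q by linarith
    have s2: "s\<^sup>2 = 1 - c\<^sup>2"
      by (simp add: s_def c_def sin_squared_eq)
    have D: "0 < 1 - 2 * q * c + q\<^sup>2"
      unfolding c_def using q by (rule poisson_denominator_pos)
    have sq: "(1 - q * c)\<^sup>2 + (q * s)\<^sup>2 = 1 - 2 * q * c + q\<^sup>2"
      unfolding power_mult_distrib s2 by (simp add: power2_eq_square algebra_simps)
    let ?N = "(2 * q * c * (1 - q * c) - q * s * (2 * q * s)) / (1 - q * c)\<^sup>2"
    have "(F has_real_derivative 1 + ?N * inverse (1 + (q * s / (1 - q * c))\<^sup>2)) (at x within {-pi..pi})"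
      unfolding F_def using nz unfolding c_def s_def
      by (auto intro!: derivative_eq_intros simp: power2_eq_square)
    also have "1 + (q * s / (1 - q * c))\<^sup>2 = (1 - 2 * q * c + q\<^sup>2) / (1 - q * c)\<^sup>2"
      using nz by (simp add: sq[symmetric] power_divide add_divide_distrib)
    also have "?N * inverse \<dots> = (2 * q * c * (1 - q * c) - q * s * (2 * q * s)) / (1 - 2 * q * c + q\<^sup>2)"
      using nz by (simp add: divide_simps)
    also have "2 * q * c * (1 - q * c) - q * s * (2 * q * s) = 2 * q * c - 2 * q\<^sup>2 * (c\<^sup>2 + s\<^sup>2)"
      by (simp add: power2_eq_square algebra_simps)
    also have "c\<^sup>2 + s\<^sup>2 = 1"
      by (simp add: s2)
    also have "1 + (2 * q * c - 2 * q\<^sup>2 * 1) / (1 - 2 * q * c + q\<^sup>2) = (1 - q\<^sup>2) / (1 - 2 * q * c + q\<^sup>2)"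
      using D by (simp add: field_simps)
    finally show ?thesis
      by (simp add: c_def)
  qed
  then have "((\<lambda>x. (1 - q\<^sup>2) / (1 - 2 * q * cos (2 * x) + q\<^sup>2)) has_integral F pi - F (-pi)) {-pi..pi}"
    by (intro fundamental_theorem_of_calculus)
      (auto simp flip: has_real_derivative_iff_has_vector_derivative)
  then show ?thesis
    by (simp add: F_def)
qed

text \<open>The denominator equals \<open>(1 - q)\<^sup>2 + 4 * q * (sin x)\<^sup>2\<close>, so
  substituting \<open>u = sin x\<close> gives an arctan integral, and \<open>u\<close> is 0 at both
  endpoints.\<close>

lemma has_integral_cos_poisson_kernel:
  fixes q :: real
  assumes q: "0 < q" "q < 1"
  shows "((\<lambda>x. cos x * (1 - q\<^sup>2) / (1 - 2 * q * cos (2 * x) + q\<^sup>2)) has_integral 0) {-pi..pi}"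
proof -
  \<comment> \<open>Chosen so that \<open>1 + (r * sin x)\<^sup>2\<close> is the denominator divided
    by \<open>(1 - q)\<^sup>2\<close>.\<close>
  define r where "r = 2 * sqrt q / (1 - q)"
  define G where "G x = (1 + q) / (1 - q) / r * arctan (r * sin x)" for x
  have r: "0 < r" "r\<^sup>2 = 4 * q / (1 - q)\<^sup>2"
    using q by (auto simp: r_def power_divide power_mult_distrib)
  have "(G has_real_derivative cos x * (1 - q\<^sup>2) / (1 - 2 * q * cos (2 * x) + q\<^sup>2)) (at x within {-pi..pi})" for x
  proof -
    have "q \<noteq> 1"
      using q by simp
    have "(G has_real_derivative (1 + q) / (1 - q) / r * (r * cos x / (1 + (r * sin x)\<^sup>2))) (at x within {-pi..pi})"
      unfolding G_def using r(1) \<open>q \<noteq> 1\<close>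
      by (auto intro!: derivative_eq_intros simp: divide_simps)
    also have "1 + (r * sin x)\<^sup>2 = (1 - 2 * q * cos (2 * x) + q\<^sup>2) / (1 - q)\<^sup>2"
    proof -
      have "1 - 2 * q * cos (2 * x) + q\<^sup>2 = (1 - q)\<^sup>2 + 4 * q * (sin x)\<^sup>2"
        unfolding cos_double_sin by (simp add: power2_eq_square algebra_simps)
      then show ?thesis
        using q by (simp add: power_mult_distrib r(2) add_divide_distrib)
    qed
    also have "(1 + q) / (1 - q) / r * (r * cos x / \<dots>)
        = cos x * (1 - q\<^sup>2) / (1 - 2 * q * cos (2 * x) + q\<^sup>2)"
    proof -
      \<comment> \<open>Valid for every real \<open>D\<close>: at \<open>D = 0\<close> both sides
        are 0 because division by zero yields 0.\<close>
      have "(1 + q) / (1 - q) / r * (r * cos x / (D / (1 - q)\<^sup>2)) = cos x * (1 - q\<^sup>2) / D" for D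
        using r(1) \<open>q \<noteq> 1\<close> by (cases "D = 0") (simp_all add: field_simps power2_eq_square)
      then show ?thesis .
    qed
    finally show ?thesis .
  qed
  then have "((\<lambda>x. cos x * (1 - q\<^sup>2) / (1 - 2 * q * cos (2 * x) + q\<^sup>2)) has_integral G pi - G (-pi)) {-pi..pi}"
    by (intro fundamental_theorem_of_calculus)
      (auto simp flip: has_real_derivative_iff_has_vector_derivative)
  then show ?thesis
    by (simp add: G_def)
qed

lemma poisson_kernel_Fourier_coefficients:
  fixes q :: real and n :: nat
  assumes q: "0 < q" "q < 1"
  shows "((\<lambda>x. cos (real n * x) * (1 - q\<^sup>2) / (1 - 2 * q * cos (2 * x) + q\<^sup>2)) has_integral
    (if even n then 2 * pi * q ^ (n div 2) else 0)) {-pi..pi}"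
proof -
  define D where "D x = 1 - 2 * q * cos (2 * x) + q\<^sup>2" for x
  define g where "g n x = cos (real n * x) * (1 - q\<^sup>2) / D x" for n :: nat and x
  define J where "J n = (if even n then 2 * pi * q ^ (n div 2) else 0)" for n :: nat
  have D: "D x \<noteq> 0" for x
    using poisson_denominator_pos[OF q, of "2 * x"] by (simp add: D_def)
  have sum_cos: "cos (real (n + 4) * x) + cos (real n * x) = 2 * cos (real (n + 2) * x) * cos (2 * x)"
    for n x
    using cos_add[of "real (n + 2) * x" "2 * x"] cos_diff[of "real (n + 2) * x" "2 * x"]
    by (simp add: algebra_simps)
  \<comment> \<open>Applied with \<open>1 + q\<^sup>2 - D x = 2 * q * cos (2 * x)\<close>: the
    \<open>D x\<close> part cancels the denominator and leaves a pure cosine, whose integral is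
    known.\<close>
  have cancel: "A = (1 + q\<^sup>2) * (c * (1 - q\<^sup>2) / D x) - (1 - q\<^sup>2) * c"
    if "A = (1 + q\<^sup>2 - D x) * c * (1 - q\<^sup>2) / D x" for A c x
    using that D[of x] by (simp add: field_simps)
  have rec: "g (n + 4) x = ((1 + q\<^sup>2) * g (n + 2) x - (1 - q\<^sup>2) * cos (real (n + 2) * x) - q * g n x) / q"
    for n x
  proof -
    have "q * g (n + 4) x + q * g n x = q * (cos (real (n + 4) * x) + cos (real n * x)) * (1 - q\<^sup>2) / D x"
      unfolding g_def by (simp add: algebra_simps add_divide_distrib diff_divide_distrib)
    also have "\<dots> = (1 + q\<^sup>2 - D x) * cos (real (n + 2) * x) * (1 - q\<^sup>2) / D x"
      unfolding sum_cos D_def by simp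
    finally have "q * g (n + 4) x + q * g n x = (1 + q\<^sup>2) * g (n + 2) x - (1 - q\<^sup>2) * cos (real (n + 2) * x)"
      unfolding g_def by (rule cancel)
    then show ?thesis
      using q by (simp add: field_simps)
  qed
  \<comment> \<open>The recurrence has order two in steps of 2, so the induction carries the indices
    \<open>n\<close> and \<open>n + 2\<close> together, separately for each parity.\<close>
  have "(g n has_integral J n) {-pi..pi} \<and> (g (n + 2) has_integral J (n + 2)) {-pi..pi}"
  proof (induction n rule: nat_induct2)
    case 0
    have g0: "(g 0 has_integral 2 * pi) {-pi..pi}"
      using has_integral_poisson_kernel[OF q] by (simp add: g_def[abs_def] D_def)
    \<comment> \<open>This is the recurrence centred at index 0: cosine is even, so the term of
      index -2 is \<open>g 2\<close> again, whence the factor \<open>2 * q\<close>.\<close>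
    have g2: "g 2 x = ((1 + q\<^sup>2) * g 0 x - (1 - q\<^sup>2)) / (2 * q)" for x
    proof -
      have "2 * q * g 2 x = (1 + q\<^sup>2) * g 0 x - (1 - q\<^sup>2) * 1"
        unfolding g_def by (simp only: of_nat_0 mult_zero_left cos_zero, rule cancel) (simp add: D_def)
      then show ?thesis
        using q by (simp add: field_simps)
    qed
    have "((\<lambda>x. ((1 + q\<^sup>2) * g 0 x - (1 - q\<^sup>2)) / (2 * q)) has_integral
        ((1 + q\<^sup>2) * (2 * pi) - (pi - (-pi)) * (1 - q\<^sup>2)) / (2 * q)) {-pi..pi}"
      using has_integral_const_real[of "1 - q\<^sup>2" "-pi" pi]
      by (intro has_integral_divide has_integral_diff has_integral_mult_right g0) simp
    also have "((1 + q\<^sup>2) * (2 * pi) - (pi - (-pi)) * (1 - q\<^sup>2)) / (2 * q) = J 2"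
      using q by (simp add: J_def field_simps power2_eq_square)
    finally have "(g 2 has_integral J 2) {-pi..pi}"
      by (simp only: g2[abs_def])
    then show ?case
      using g0 by (simp add: J_def numeral_2_eq_2)
  next
    case 1
    have g1: "(g 1 has_integral 0) {-pi..pi}"
      using has_integral_cos_poisson_kernel[OF q] by (simp add: g_def[abs_def] D_def)
    \<comment> \<open>The recurrence centred at index 1, where the term of index -1 is
      \<open>g 1\<close> by evenness.\<close>
    have g3: "g 3 x = ((1 + q\<^sup>2) * g 1 x - (1 - q\<^sup>2) * cos (real 1 * x) - q * g 1 x) / q" for x
    proof -
      have "cos (3 * x) + cos x = 2 * cos x * cos (2 * x)"
        by (simp add: cos_plus_cos)
      moreover have "q * g 3 x + q * g 1 x = q * (cos (3 * x) + cos x) * (1 - q\<^sup>2) / D x"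
        unfolding g_def by (simp add: algebra_simps add_divide_distrib diff_divide_distrib)
      ultimately have "q * g 3 x + q * g 1 x = q * (2 * cos x * cos (2 * x)) * (1 - q\<^sup>2) / D x"
        by simp
      also have "\<dots> = (1 + q\<^sup>2 - D x) * cos (real 1 * x) * (1 - q\<^sup>2) / D x"
        unfolding D_def by simp
      finally have "q * g 3 x + q * g 1 x = (1 + q\<^sup>2) * g 1 x - (1 - q\<^sup>2) * cos (real 1 * x)"
        unfolding g_def by (rule cancel)
      then show ?thesis
        using q by (simp add: field_simps)
    qed
    have "((\<lambda>x. ((1 + q\<^sup>2) * g 1 x - (1 - q\<^sup>2) * cos (real 1 * x) - q * g 1 x) / q) has_integral
        ((1 + q\<^sup>2) * 0 - (1 - q\<^sup>2) * 0 - q * 0) / q) {-pi..pi}"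
      by (intro has_integral_divide has_integral_diff has_integral_mult_right g1 has_integral_cos_multiple) simp
    also have "((1 + q\<^sup>2) * 0 - (1 - q\<^sup>2) * 0 - q * 0) / q = 0"
      by simp
    finally have "(g 3 has_integral 0) {-pi..pi}"
      by (simp only: g3[abs_def])
    then show ?case
      using g1 by (simp add: J_def numeral_3_eq_3)
  next
    case (step n)
    have "((\<lambda>x. ((1 + q\<^sup>2) * g (n + 2) x - (1 - q\<^sup>2) * cos (real (n + 2) * x) - q * g n x) / q) has_integral
        ((1 + q\<^sup>2) * J (n + 2) - (1 - q\<^sup>2) * 0 - q * J n) / q) {-pi..pi}"
      using step
      by (intro has_integral_divide has_integral_diff has_integral_mult_right has_integral_cos_multiple) auto
    moreover have "((1 + q\<^sup>2) * J (n + 2) - (1 - q\<^sup>2) * 0 - q * J n) / q = J (n + 4)"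
      using q by (simp add: J_def field_simps power2_eq_square)
    ultimately have "(g (n + 4) has_integral J (n + 4)) {-pi..pi}"
      by (simp only: rec[abs_def])
    then show ?case
      using step by (simp add: numeral_eq_Suc)
  qed
  then show ?thesis
    by (simp add: g_def[abs_def] D_def J_def)
qed

text \<open>Square \<open>exp (arsinh u) = u + sqrt (u\<^sup>2 + 1)\<close> at
  \<open>u = sqrt k\<close>. This ties the cosh in the final formula to its power terms.\<close>

lemma exp_two_arsinh_sqrt:
  fixes k :: real
  assumes "0 < k"
  shows "exp (2 * arsinh (sqrt k)) = 2 * k + 1 + 2 * sqrt (k * (k + 1))"
proof -
  have "exp (arsinh (sqrt k)) = sqrt k + sqrt (k + 1)"
    using assms by (simp add: arsinh_real_def add_pos_pos)
  then have "exp (2 * arsinh (sqrt k)) = (sqrt k + sqrt (k + 1))\<^sup>2"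
    by (simp add: exp_double)
  then show ?thesis
    using assms by (simp add: power2_sum real_sqrt_mult)
qed

theorem theorem2:
  fixes k :: real and n :: nat
  assumes "k > 0"
  shows "((\<lambda>x::real. cos (real n * x) / (k + (sin x)^2)) has_integral
      ((-1)^n + 1) / 2 * pi *
        (- (((2*k + 1 + 2 * sqrt (k * (k + 1))) ^ nat \<lfloor>real n / 2\<rfloor>
              - (2*k + 1 - 2 * sqrt (k * (k + 1))) ^ nat \<lfloor>real n / 2\<rfloor>)
             / sqrt (k * (k + 1)))
         + cosh (2 * real_of_int \<lfloor>real n / 2\<rfloor> * arsinh (sqrt k))
             * (2 / sqrt (k * (k + 1))))) {-pi..pi}"
proof -
  define s where "s = sqrt (k * (k + 1))"
  define p where "p = 2 * k + 1 + 2 * s"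
  define q where "q = 2 * k + 1 - 2 * s"
  define m where "m = n div 2"
  have s: "0 < s" "s\<^sup>2 = k * (k + 1)"
    using assms by (auto simp: s_def)
  \<comment> \<open>Difference of squares:
    \<open>(2 * k + 1)\<^sup>2 - 4 * k * (k + 1) = 1\<close>.\<close>
  have pq: "p * q = 1"
    using s(2) by (simp add: p_def q_def power2_eq_square algebra_simps)
  have p: "1 < p"
    using assms s by (simp add: p_def)
  have q_inv: "q = inverse p"
    using pq p by (simp add: field_simps)
  then have q: "0 < q" "q < 1"
    using p by (simp_all add: q_inv inverse_less_1_iff)
  have q_k: "1 + q\<^sup>2 = 2 * q * (2 * k + 1)"
  proof -
    have "q * (p + q) = 2 * q * (2 * k + 1)"
      by (simp add: p_def q_def algebra_simps)
    then show ?thesis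
      using pq by (simp add: power2_eq_square algebra_simps)
  qed
  have q_s: "1 - q\<^sup>2 = 4 * q * s"
  proof -
    have "q * (p - q) = 4 * q * s"
      by (simp add: p_def q_def)
    then show ?thesis
      using pq by (simp add: power2_eq_square algebra_simps)
  qed
  have denom: "1 - 2 * q * cos (2 * x) + q\<^sup>2 = 4 * q * (k + (sin x)\<^sup>2)" for x
    using q_k unfolding cos_double_sin by (simp add: algebra_simps)
  \<comment> \<open>Numerator and denominator share the factor \<open>4 * q\<close>, so the kernel
    is \<open>s / (k + (sin x)\<^sup>2)\<close>.\<close>
  have kernel: "cos (real n * x) * (1 - q\<^sup>2) / (1 - 2 * q * cos (2 * x) + q\<^sup>2) / s
      = cos (real n * x) / (k + (sin x)\<^sup>2)" for x
    unfolding denom q_s using q s by simp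
  have int: "((\<lambda>x. cos (real n * x) / (k + (sin x)\<^sup>2)) has_integral
      (if even n then 2 * pi * q ^ m else 0) / s) {-pi..pi}"
    using has_integral_divide[OF poisson_kernel_Fourier_coefficients[OF q, of n], of s]
    by (simp only: kernel m_def)
  have fl: "\<lfloor>real n / 2\<rfloor> = int m"
    using floor_divide_of_nat_eq[of n 2] by (simp add: m_def)
  have "exp (2 * real m * arsinh (sqrt k)) = p ^ m"
    using exp_two_arsinh_sqrt[OF assms] exp_of_nat_mult[of m "2 * arsinh (sqrt k)"]
    by (simp add: p_def s_def mult_ac)
  then have cosh: "cosh (2 * real m * arsinh (sqrt k)) = (p ^ m + q ^ m) / 2"
    by (simp add: cosh_def exp_minus q_inv power_inverse)
  \<comment> \<open>The bracket collapses to \<open>2 * q ^ m / s\<close>, and the prefactor is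
    \<open>pi\<close> for even \<open>n\<close> and 0 for odd \<open>n\<close>.\<close>
  have "((-1) ^ n + 1) / 2 * pi * (- ((p ^ m - q ^ m) / s) + (p ^ m + q ^ m) / 2 * (2 / s))
      = (if even n then 2 * pi * q ^ m else 0) / s"
    using s by (simp add: field_simps)
  then show ?thesis
    using int unfolding s_def[symmetric] p_def[symmetric] q_def[symmetric] fl
    by (simp add: cosh)
qed

end
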